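(* Let $T$ be a tournament on $\{1,\ldots,n\}$. Suppose $T$ contains a closed alternating walk $(c_0,c_1,\ldots,c_{2k-1})$, that is, a closed directed walk $c_0\to c_1\to\cdots\to c_{2k-1}\to c_0$ in which descents and ascents alternate. Then $T$ contains an alternating cycle of length $4$.
   Context: A tournament on $\{1,\ldots,n\}$ is a directed graph on the vertex set $\{1,\ldots,n\}$ with no loops or multiple edges such that for each pair $i\neq j$ exactly one of the arcs $i\to j$, $j\to i$ is present. An arc $i\to j$ is an ascent if $i<j$ and a descent if $i>j$. A directed cycle $(c_0,\ldots,c_{2k-1})$ (indices mod $2k$) is alternating if ascents and descents alternate along it, i.e. $c_{2j}\to c_{2j+1}$ are descents and $c_{2j+1}\to c_{2j+2}$ are ascents for all $j$. In a walk, vertices may be revisited. *)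

theory Defs
  imports "Graph_Theory.Graph_Theory"
begin

locale tournament = pair_digraph T for n :: nat and T :: "nat pair_pre_digraph" +
  assumes verts_eq: "pverts T = {1..n}"
    and exactly_one_arc:
      "\<lbrakk>i \<in> {1..n}; j \<in> {1..n}; i \<noteq> j\<rbrakk> \<Longrightarrow> ((i, j) \<in> parcs T) \<noteq> ((j, i) \<in> parcs T)"

definition ascent :: "nat \<times> nat \<Rightarrow> bool" where
  "ascent e \<longleftrightarrow> fst e < snd e"

definition descent :: "nat \<times> nat \<Rightarrow> bool" where
  "descent e \<longleftrightarrow> fst e > snd e"

text \<open>
  As in the library, a closed walk is given by the list of its arcs: the closed walk through
  \<open>c 0, \<dots>, c (2 * k - 1)\<close> is \<open>[(c 0, c 1), (c 1, c 2), \<dots>, (c (2 * k - 1), c 0)]\<close>,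
  a list of length \<open>2 * k\<close> whose arc number \<open>i\<close> has tail \<open>c i\<close>. The vertex sequence is
  rotated so that the arcs leaving \<open>c (2 * j)\<close> are the descents. Both
  \<open>closed_w\<close> and \<open>cycle\<close> exclude the empty list; \<open>cycle\<close> moreover requires the
  \<open>c i\<close> to be distinct.
\<close>

definition alternating :: "(nat \<times> nat) list \<Rightarrow> bool" where
  "alternating p \<longleftrightarrow> even (length p) \<and>
     (\<forall>i < length p. if even i then descent (p ! i) else ascent (p ! i))"

definition closed_alternating_walk :: "nat pair_pre_digraph \<Rightarrow> (nat \<times> nat) list \<Rightarrow> bool" where
  "closed_alternating_walk T p \<longleftrightarrow> wf_digraph.closed_w (with_proj T) p \<and> alternating p"

definition alternating_cycle :: "nat pair_pre_digraph \<Rightarrow> (nat \<times> nat) list \<Rightarrow> bool" where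
  "alternating_cycle T p \<longleftrightarrow> pre_digraph.cycle (with_proj T) p \<and> alternating p"

end

theory Submission
  imports Defs
begin

text \<open>
  Call \<open>x\<close> related to \<open>y\<close> if \<open>x \<rightarrow> v \<rightarrow> y\<close> with \<open>v < x\<close> and \<open>v < y\<close>; a closed alternating walk
  is a cycle of this relation on its peaks. Given \<open>x \<rightarrow> v \<rightarrow> y \<rightarrow> w \<rightarrow> z\<close> with \<open>y \<le> x\<close>, we have
  \<open>w < x\<close>: the arc \<open>w \<rightarrow> x\<close> would close an alternating 4-cycle, so otherwise \<open>x \<rightarrow> w\<close> and the walk
  can be shortened to \<open>x \<rightarrow> w \<rightarrow> z\<close>. Starting from the largest vertex lying on a cycle of the
  relation, repeated shortening ends in \<open>x \<rightarrow> v \<rightarrow> x\<close>, which a tournament does not contain.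
\<close>

definition alternating_step :: "nat pair_pre_digraph \<Rightarrow> (nat \<times> nat) set" where
  "alternating_step T =
     {(x, y). \<exists>v. (x, v) \<in> parcs T \<and> (v, y) \<in> parcs T \<and> descent (x, v) \<and> ascent (v, y)}"

lemma alternating_Cons_Cons:
  "alternating (e # f # p) \<longleftrightarrow> descent e \<and> ascent f \<and> alternating p"
proof -
  \<comment> \<open>Removing two arcs keeps the parity of the remaining positions.\<close>
  have "(\<forall>i < Suc (Suc m). Q i) \<longleftrightarrow> Q 0 \<and> Q (Suc 0) \<and> (\<forall>i < m. Q (Suc (Suc i)))" for m Q
    by (simp add: All_less_Suc2)
  then show ?thesis
    by (auto simp: alternating_def)
qed

context tournament
begin

lemma not_parc_reverse:
  assumes "(x, y) \<in> parcs T"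
  shows "(y, x) \<notin> parcs T"
proof -
  have "x \<in> {1..n}" "y \<in> {1..n}" "x \<noteq> y"
    using assms wellformed[OF assms] no_loops[OF assms] verts_eq by auto
  then show ?thesis
    using exactly_one_arc assms by blast
qed

text \<open>The walk is consumed two arcs at a time, each descent-ascent pair being one step; even
  length excludes a leftover arc.\<close>

lemma alternating_step_rtrancl_of_awalk:
  assumes "awalk x p y" "alternating p"
  shows "(x, y) \<in> (alternating_step T)\<^sup>*"
  using assms
proof (induction p arbitrary: x rule: induct_list012)
  case 1
  then show ?case by (simp add: awalk_Nil_iff)
next
  case (2 e)
  then show ?case by (simp add: alternating_def)
next
  case (3 e f p)
  then have "(x, snd f) \<in> alternating_step T"
    unfolding alternating_step_def
    by (cases e; cases f) (auto simp: awalk_Cons_iff alternating_Cons_Cons)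
  moreover have "(snd f, y) \<in> (alternating_step T)\<^sup>*"
    using 3 by (auto simp: awalk_Cons_iff alternating_Cons_Cons)
  ultimately show ?case by (rule converse_rtrancl_into_rtrancl)
qed

lemma alternating_step_trancl_of_closed_walk:
  assumes "closed_alternating_walk T p"
  shows "\<exists>x. (x, x) \<in> (alternating_step T)\<^sup>+"
proof -
  obtain x where x: "awalk x p x" "p \<noteq> []" and alt: "alternating p"
    using assms by (auto simp: closed_alternating_walk_def closed_w_def)
  then obtain e f q where p: "p = e # f # q"
    \<comment> \<open>This rule splits off lists of length 0 and 1, excluded by nonemptiness and
      parity.\<close>
    by (cases p rule: remdups_adj.cases) (auto simp: alternating_def)
  have "(x, snd f) \<in> alternating_step T"
    using x alt p unfolding alternating_step_def
    by (cases e; cases f) (auto simp: awalk_Cons_iff alternating_Cons_Cons)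
  moreover have "(snd f, x) \<in> (alternating_step T)\<^sup>*"
    using x alt p by (intro alternating_step_rtrancl_of_awalk[of _ q])
      (auto simp: awalk_Cons_iff alternating_Cons_Cons)
  ultimately show ?thesis by (meson rtrancl_into_trancl2)
qed

lemma alternating_4_cycle:
  assumes "(a, b) \<in> parcs T" "(b, c) \<in> parcs T" "(c, d) \<in> parcs T" "(d, a) \<in> parcs T"
    and "b < a" "b < c" "d < c" "d < a"
  shows "alternating_cycle T [(a, b), (b, c), (c, d), (d, a)]"
proof -
  \<comment> \<open>Equality would make two consecutive arcs mutually reverse.\<close>
  have "a \<noteq> c" "b \<noteq> d"
    using assms not_parc_reverse by blast+
  moreover have "a \<in> pverts T" "b \<in> pverts T" "c \<in> pverts T" "d \<in> pverts T"
    using assms by (auto dest: wellformed)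
  ultimately show ?thesis
    using assms unfolding alternating_cycle_def cycle_def
    by (auto simp: alternating_Cons_Cons awalk_Cons_iff awalk_Nil_iff
        alternating_def[of "[]"] descent_def ascent_def)
qed

lemma alternating_step_shortcut:
  assumes no4: "\<nexists>q. alternating_cycle T q \<and> length q = 4"
    and xy: "(x, y) \<in> alternating_step T" and yz: "(y, z) \<in> alternating_step T" and "y \<le> x"
  shows "(x, z) \<in> alternating_step T"
proof -
  obtain v where v: "(x, v) \<in> parcs T" "(v, y) \<in> parcs T" "v < x" "v < y"
    using xy by (auto simp: alternating_step_def descent_def ascent_def)
  obtain w where w: "(y, w) \<in> parcs T" "(w, z) \<in> parcs T" "w < y" "w < z"
    using yz by (auto simp: alternating_step_def descent_def ascent_def)
  \<comment> \<open>Otherwise \<open>x\<close>, \<open>v\<close>, \<open>y\<close>, \<open>w\<close>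
    form an alternating cycle, as \<open>w < y \<le> x\<close>.\<close>
  have "(w, x) \<notin> parcs T"
    using alternating_4_cycle[of x v y w] no4 v w \<open>y \<le> x\<close> by fastforce
  moreover have "x \<in> {1..n}" "w \<in> {1..n}" "x \<noteq> w"
    using v w \<open>y \<le> x\<close> wellformed[OF v(1)] wellformed[OF w(1)] verts_eq by auto
  ultimately have "(x, w) \<in> parcs T"
    using exactly_one_arc by blast
  then show ?thesis
    using w \<open>y \<le> x\<close> by (auto simp: alternating_step_def descent_def ascent_def)
qed

lemma acyclic_alternating_step:
  assumes no4: "\<nexists>q. alternating_cycle T q \<and> length q = 4"
  shows "acyclic (alternating_step T)"
proof (rule acyclicI, rule allI, rule notI)
  fix x0
  assume x0: "(x0, x0) \<in> (alternating_step T)\<^sup>+"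
  let ?R = "alternating_step T"
  define C where "C = {x. (x, x) \<in> ?R\<^sup>+}"
  have "x \<in> pverts T" if "(x, y) \<in> ?R" for x y
    using that in_arcsD1 by (auto simp: alternating_step_def)
  then have "C \<subseteq> pverts T"
    by (auto simp: C_def dest: tranclD)
  then have fin: "finite C"
    using finite_subset verts_eq by auto
  define m where "m = Max C"
  have "C \<noteq> {}" using x0 by (auto simp: C_def)
  with fin have "m \<in> C" unfolding m_def by (rule Max_in)
  have max: "\<And>x. x \<in> C \<Longrightarrow> x \<le> m"
    using fin by (simp add: m_def)
  \<comment> \<open>The condition \<open>(y, m) \<in> ?R\<^sup>*\<close> keeps every intermediate
    vertex on a cycle through \<open>m\<close>, hence in \<open>C\<close> and at most
    \<open>m\<close>, so the shortcut always applies at \<open>m\<close>.\<close>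
  have "(m, y) \<in> ?R" if "(m, y) \<in> ?R\<^sup>+" "(y, m) \<in> ?R\<^sup>*" for y
    using that
  proof (induction rule: trancl_induct)
    case (step y z)
    then have "(y, m) \<in> ?R\<^sup>*" by (simp add: converse_rtrancl_into_rtrancl)
    with step.hyps have "y \<in> C" unfolding C_def by (simp add: rtrancl_trancl_trancl)
    then show ?case
      using alternating_step_shortcut[OF no4] step \<open>(y, m) \<in> ?R\<^sup>*\<close> max by blast
  qed
  then have "(m, m) \<in> ?R"
    using \<open>m \<in> C\<close> by (simp add: C_def)
  then show False
    using not_parc_reverse by (auto simp: alternating_step_def)
qed

end

theorem theorem2p2:
  fixes n :: nat and T :: "nat pair_pre_digraph"
  assumes "tournament n T"
    and "\<exists>p. closed_alternating_walk T p"
  shows "\<exists>q. alternating_cycle T q \<and> length q = 4"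
proof -
  interpret tournament n T by fact
  show ?thesis
    using assms(2) alternating_step_trancl_of_closed_walk acyclic_alternating_step
    unfolding acyclic_def by blast
qed

end
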